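(* Let $\text{D-Opt}(A,B,s)$ be an arbitrary 0/1 D-Opt instance with $A\in\mathbb{R}^{n\times m}$, $B\in\mathbb{R}^{q\times m}$. Let $C:=I_n-A(A^\top A+B^\top B)^{-1}A^\top$, let $\lambda_{\max}$ be the greatest eigenvalue of $C$, and let $\Phi\Lambda\Phi^\top$ be any real Schur decomposition of $C$. Then $$\mathcal{D}(\mathcal{M}(\text{D-Opt}(A,B,s));\Phi)+\operatorname{ldet}(A^\top A+B^\top B)+s\log\lambda_{\max}\;\equiv\;\text{D-Opt}(A,B,s).$$ That is, with $\tilde A:=\Phi(I_n-\frac{1}{\lambda_{\max}}\Lambda)^{1/2}$ and $\tilde B:=\frac{1}{\sqrt{\lambda_{\max}}}\Lambda^{1/2}$, for every feasible solution $S\subset\{1,\dots,n\}$, $|S|=s$, $$\operatorname{ldet}\left(\tilde A_{S\cdot}^\top\tilde A_{S\cdot}+\tilde B^\top\tilde B\right)+\operatorname{ldet}(A^\top A+B^\top B)+s\log\lambda_{\max}=\operatorname{ldet}\left(A_{S\cdot}^\top A_{S\cdot}+B^\top B\right).$$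
   Context: $\operatorname{ldet}$ is the natural logarithm of the determinant. $A_{S\cdot}$ is the submatrix of $A$ with rows indexed by $S$, and $C_{T,T}$ is the principal submatrix of $C$ indexed by $T$. A 0/1 D-Opt instance $\text{D-Opt}(A,B,s)$ is given by $A\in\mathbb{R}^{n\times m}$ with no all-zero rows, $B\in\mathbb{R}^{q\times m}$ ($q\ge1$, all-zero rows allowed), such that $\begin{pmatrix} A \\ B \end{pmatrix}$ has full column rank $m$, and an integer $s$ with $n>s\ge m-\operatorname{rank}(B)$; the problem is to maximize $\operatorname{ldet}(A_{S\cdot}^\top A_{S\cdot}+B^\top B)$ over $S\subset\{1,\dots,n\}$ with $|S|=s$. For a symmetric positive-semidefinite matrix $C$ of order $n$, $\mathrm{MESP}(C,t)$ is the problem of maximizing $\operatorname{ldet}(C_{T,T})$ over $T\subset\{1,\dots,n\}$ with $|T|=t$. Map $\mathcal{M}$: $\mathcal{M}(\text{D-Opt}(A,B,s)):=\mathrm{MESP}(C,n-s)$ with $C:=I_n-A(A^\top A+B^\top B)^{-1}A^\top$. Map $\mathcal{D}$: $\mathcal{D}(\mathrm{MESP}(C,t);\Phi):=\text{D-Opt}(\Phi(I_n-\frac{1}{\lambda_{\max}}\Lambda)^{1/2},\frac{1}{\sqrt{\lambda_{\max}}}\Lambda^{1/2},n-t)$, where $C=\Phi\Lambda\Phi^\top$ with $\Phi$ orthogonal and $\Lambda$ diagonal (a real Schur decomposition), and $\lambda_{\max}$ is the greatest eigenvalue of $C$. For a problem $P$ and a constant $K$, $P+K$ is $P$ with $K$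 added to its objective function. For problems $P,Q$ with identical feasible sets in $\{0,1\}^n$ (sets $S$ being identified with their 0/1 characteristic vectors), $Q\equiv P+K$ ("$P$ and $Q$ are completely equivalent") means that every feasible solution has objective value in $Q$ exactly $K$ more than in $P$.
   Formalization: The constant s log λ_max is corrected to (n−s) log λ_max; as printed the identity fails, e.g. for A=B=I_3, s=1, where the left side is log 4 and the right side log 2. *)

theory Defs
  imports "HOL-Analysis.Analysis"
begin

subsection \<open>Problems over subsets of a finite ground set\<close>

text \<open>
  The logarithm of a determinant is extended-real valued, with \<open>ldet M = -\<infinity>\<close> for singular \<open>M\<close>:
  a feasible set may well have a singular information matrix (and \<open>ln 0 = 0\<close> in HOL).
\<close>

definition ln_ext :: "real \<Rightarrow> ereal" where
  "ln_ext x = (if 0 < x then ereal (ln x) else -\<infinity>)"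

definition ldet :: "real^'k^'k \<Rightarrow> ereal" where
  "ldet M = ln_ext (det M)"

record 'n set_problem =
  feasible :: "'n set set"
  objective :: "'n set \<Rightarrow> ereal"

definition add_const :: "'n set_problem \<Rightarrow> real \<Rightarrow> 'n set_problem" where
  "add_const P K = \<lparr>feasible = feasible P, objective = (\<lambda>S. objective P S + ereal K)\<rparr>"

definition completely_equivalent :: "'n set_problem \<Rightarrow> 'n set_problem \<Rightarrow> bool" where
  "completely_equivalent P Q \<longleftrightarrow>
     feasible P = feasible Q \<and> (\<forall>S\<in>feasible P. objective P S = objective Q S)"

subsection \<open>The 0/1 D-optimality problem\<close>

datatype ('n::finite, 'm::finite, 'q::finite) dopt_instance =
  DOpt "real^'m^'n" "real^'m^'q" nat

text \<open>\<open>gram_rows A S\<close> is the product of the transpose of \<open>A\<^sub>S\<close> with \<open>A\<^sub>S\<close>, where \<open>A\<^sub>S\<close> is the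
  submatrix of \<open>A\<close> with rows indexed by \<open>S\<close>: the matrix product with its summation index
  running over \<open>S\<close>, since \<open>S\<close> cannot be the index type of a matrix.\<close>

definition gram_rows :: "real^'m^'n \<Rightarrow> 'n set \<Rightarrow> real^'m^'m" where
  "gram_rows A S = (\<chi> j k. \<Sum>i\<in>S. A $ i $ j * A $ i $ k)"

fun dopt_problem :: "('n::finite, 'm::finite, 'q::finite) dopt_instance \<Rightarrow> 'n set_problem" where
  "dopt_problem (DOpt A B s) =
     \<lparr>feasible = {S. card S = s},
      objective = (\<lambda>S. ldet (gram_rows A S + transpose B ** B))\<rparr>"

definition vstack :: "real^'m^'n \<Rightarrow> real^'m^'q \<Rightarrow> real^'m^('n + 'q)" where
  "vstack A B = (\<chi> r. case r of Inl i \<Rightarrow> A $ i | Inr k \<Rightarrow> B $ k)"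

fun valid_dopt :: "('n::finite, 'm::finite, 'q::finite) dopt_instance \<Rightarrow> bool" where
  "valid_dopt (DOpt A B s) \<longleftrightarrow>
     (\<forall>i. A $ i \<noteq> 0) \<and>
     rank (vstack A B) = CARD('m) \<and>
     s < CARD('n) \<and> int CARD('m) - int (rank B) \<le> int s"

subsection \<open>The maximum-entropy sampling problem\<close>

datatype 'n::finite mesp_instance = MESP "real^'n^'n" nat

text \<open>\<open>principal_minor C T\<close> is the determinant of the principal submatrix of \<open>C\<close> indexed by \<open>T\<close>
  (the Leibniz formula, as in the library definition of \<open>det\<close>, over the permutations of \<open>T\<close>).\<close>

definition principal_minor :: "real^'n^'n \<Rightarrow> 'n set \<Rightarrow> real" where
  "principal_minor C T =
     (\<Sum>p\<in>{p. p permutes T}. of_int (sign p) * (\<Prod>i\<in>T. C $ i $ p i))"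

fun mesp_problem :: "'n::finite mesp_instance \<Rightarrow> 'n set_problem" where
  "mesp_problem (MESP C t) =
     \<lparr>feasible = {T. card T = t}, objective = (\<lambda>T. ln_ext (principal_minor C T))\<rparr>"

subsection \<open>The maps between the two problems\<close>

definition greatest_eigenvalue :: "real^'n^'n \<Rightarrow> real" where
  "greatest_eigenvalue C = Max {l. \<exists>v. v \<noteq> 0 \<and> C *v v = l *\<^sub>R v}"

definition diagonal_matrix :: "real^'n^'n \<Rightarrow> bool" where
  "diagonal_matrix L \<longleftrightarrow> (\<forall>i j. i \<noteq> j \<longrightarrow> L $ i $ j = 0)"

definition real_schur :: "real^'n^'n \<Rightarrow> real^'n^'n \<Rightarrow> real^'n^'n \<Rightarrow> bool" where
  "real_schur C \<Phi> \<Lambda> \<longleftrightarrow>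
     orthogonal_matrix \<Phi> \<and> diagonal_matrix \<Lambda> \<and> C = \<Phi> ** \<Lambda> ** transpose \<Phi>"

text \<open>The positive-semidefinite square root of a diagonal matrix with nonnegative diagonal.\<close>

definition diag_sqrt :: "real^'n^'n \<Rightarrow> real^'n^'n" where
  "diag_sqrt L = (\<chi> i j. if i = j then sqrt (L $ i $ i) else 0)"

fun map_M :: "('n::finite, 'm::finite, 'q::finite) dopt_instance \<Rightarrow> 'n mesp_instance" where
  "map_M (DOpt A B s) =
     MESP (mat 1 - A ** matrix_inv (transpose A ** A + transpose B ** B) ** transpose A)
       (CARD('n) - s)"

text \<open>\<open>map_D\<close> takes both factors of the decomposition of \<open>C\<close>; \<open>\<Lambda>\<close> is determined by \<open>C\<close> and \<open>\<Phi>\<close>.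
  The matrix that \<open>map_M\<close> assigns to the resulting instance is \<open>C\<close> divided by its greatest
  eigenvalue \<open>l\<close>, so principal minors of order \<open>t\<close> are divided by \<open>l ^ t\<close>.  Hence \<open>map_D\<close> applied
  to \<open>MESP C t\<close> is compensated by the constant \<open>t * ln l\<close>; after \<open>map_M\<close> the order is
  \<open>t = n - s\<close>, and the constant is \<open>(n - s) * ln l\<close>, not \<open>s * ln l\<close>.\<close>

fun map_D :: "real^'n^'n \<Rightarrow> real^'n^'n \<Rightarrow> 'n::finite mesp_instance \<Rightarrow> ('n, 'n, 'n) dopt_instance" where
  "map_D \<Phi> \<Lambda> (MESP C t) =
     DOpt (\<Phi> ** diag_sqrt (mat 1 - (1 / greatest_eigenvalue C) *\<^sub>R \<Lambda>))
       ((1 / sqrt (greatest_eigenvalue C)) *\<^sub>R diag_sqrt \<Lambda>)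
       (CARD('n) - t)"

end

theory Submission
  imports Defs
begin

text \<open>
  Put \<open>H = A\<^sup>T A + B\<^sup>T B\<close> and let \<open>T\<close> be the complement of \<open>S\<close>. Removing the rows in \<open>T\<close> from the Gram
  matrix and using \<open>det (1 - X Y) = det (1 - Y X)\<close>, the D-optimality determinant of \<open>S\<close> is \<open>det H\<close>
  times the determinant of \<open>C = 1 - A H\<^sup>-\<^sup>1 A\<^sup>T\<close> with its rows in \<open>S\<close> replaced by identity rows. For the
  second instance \<open>H\<close> is the identity and \<open>C\<close> becomes \<open>C / \<lambda>\<close>, with \<open>\<lambda>\<close> the greatest eigenvalue of \<open>C\<close>,
  so the two determinants differ by the factor \<open>det H\<close> and one factor \<open>\<lambda>\<close> for each row in \<open>T\<close>. If
  \<open>\<lambda>\<close> were zero, then \<open>C = 0\<close> and the image of \<open>H\<^sup>-\<^sup>1 A\<^sup>T\<close> would be an \<open>n\<close>-dimensional subspace of the kernel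
  of \<open>B\<close>, against \<open>m - rank B \<le> s < n\<close>.
\<close>

section \<open>Block determinants and the exchange identity\<close>

text \<open>In the Leibniz sum, a permutation that moves an index outside \<open>range f\<close>
  picks an off-diagonal zero of an identity row. The surviving permutations are those of
  \<open>range f\<close>, which correspond through \<open>f\<close> to the permutations of the
  smaller index type, with the same sign.\<close>

lemma det_eq_det_of_identity_rows:
  fixes M :: "'a::comm_ring_1^'k^'k" and f :: "'m::finite \<Rightarrow> 'k"
  assumes f: "inj f" and M: "\<And>i. i \<notin> range f \<Longrightarrow> M $ i = mat 1 $ i"
  shows "det M = det (\<chi> i j. M $ f i $ f j)"
proof -
  let ?t = "\<lambda>p. of_int (sign p) * (\<Prod>i\<in>UNIV. M $ i $ p i)"
  let ?g = "map_permutation UNIV f"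
  let ?P = "{p. p permutes (UNIV :: 'm set)}"
  have g_f: "?g p (f i) = f (p i)" for p i
    using f by (simp add: map_permutation_def restrict_id_def)
  have g_out: "?g p i = i" if "i \<notin> range f" for p i
    using that by (simp add: map_permutation_def restrict_id_def)
  have bij: "bij_betw f UNIV (range f)"
    using f by (simp add: bij_betw_def)
  \<comment> \<open>For surjectivity, a permutation of \<open>range f\<close> is pulled back by
    conjugating with the inverse of \<open>f\<close>.\<close>
  have img: "?g ` ?P = {p. p permutes range f}"
  proof (intro equalityI subsetI)
    fix p assume "p \<in> {p. p permutes range f}"
    then have p: "p permutes range f" by simp
    let ?q = "map_permutation (range f) (inv f) p"
    have "?q permutes UNIV"
      using map_permutation_permutes[OF bij_betw_inv_into[OF bij] p] by simp
    moreover have "?g ?q = p"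
      using map_permutation_compose_inv[OF bij_betw_inv_into[OF bij] p, of f]
      by (simp add: f_inv_into_f)
    ultimately show "p \<in> ?g ` ?P" by (metis imageI mem_Collect_eq)
  qed (auto intro: map_permutation_permutes[OF bij])
  have inj: "inj_on ?g ?P"
  proof (rule inj_onI)
    fix p q assume "?g p = ?g q"
    then have "f (p i) = f (q i)" for i by (metis g_f)
    then show "p = q" using f by (auto simp: inj_def)
  qed
  have "det M = (\<Sum>p\<in>{p. p permutes UNIV}. ?t p)"
    by (simp add: det_def)
  also have "\<dots> = (\<Sum>p\<in>{p. p permutes range f}. ?t p)"
  proof (rule sum.mono_neutral_right)
    show "\<forall>p\<in>{p. p permutes UNIV} - {p. p permutes range f}. ?t p = 0"
    proof
      fix p :: "'k \<Rightarrow> 'k" assume "p \<in> {p. p permutes UNIV} - {p. p permutes range f}"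
      then obtain i where i: "i \<notin> range f" "p i \<noteq> i"
        by (auto simp: permutes_def)
      then have "M $ i $ p i = 0" by (simp add: M mat_def)
      then have "(\<Prod>i\<in>UNIV. M $ i $ p i) = 0" by (intro prod_zero) auto
      then show "?t p = 0" by simp
    qed
  qed (auto intro: permutes_subset finite_permutations)
  also have "\<dots> = (\<Sum>p\<in>?P. ?t (?g p))"
    unfolding img[symmetric] using sum.reindex[OF inj, of ?t] by simp
  also have "\<dots> = det (\<chi> i j. M $ f i $ f j)"
    unfolding det_def
  proof (rule sum.cong[OF refl])
    fix p :: "'m \<Rightarrow> 'm" assume "p \<in> ?P"
    then have p: "p permutes UNIV" by simp
    have "(\<Prod>i\<in>UNIV. M $ i $ ?g p i) = (\<Prod>i\<in>range f. M $ i $ ?g p i)"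
      by (rule prod.mono_neutral_right) (auto simp: g_out M mat_def)
    also have "\<dots> = (\<Prod>i\<in>UNIV. M $ f i $ f (p i))"
      using f by (simp add: prod.reindex g_f)
    finally show "?t (?g p) = of_int (sign p) *
        (\<Prod>i\<in>UNIV. (\<chi> i j. M $ f i $ f j) $ i $ p i)"
      using sign_map_permutation[OF f p] by simp
  qed
  finally show ?thesis .
qed

definition block_matrix ::
  "'a^'n^'n \<Rightarrow> 'a^'m^'n \<Rightarrow> 'a^'n^'m \<Rightarrow> 'a^'m^'m \<Rightarrow> 'a^('n + 'm)^('n + 'm)" where
  "block_matrix W X Y Z = (\<chi> r c. case r of
     Inl i \<Rightarrow> (case c of Inl j \<Rightarrow> W $ i $ j | Inr l \<Rightarrow> X $ i $ l)
   | Inr k \<Rightarrow> (case c of Inl j \<Rightarrow> Y $ k $ j | Inr l \<Rightarrow> Z $ k $ l))"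

lemma sum_UNIV_sum_type:
  fixes g :: "'n::finite + 'm::finite \<Rightarrow> 'a::comm_monoid_add"
  shows "sum g UNIV = (\<Sum>i\<in>UNIV. g (Inl i)) + (\<Sum>k\<in>UNIV. g (Inr k))"
  using sum.Plus[of "UNIV :: 'n set" "UNIV :: 'm set" g] by (simp add: comp_def)

lemma block_matrix_mult:
  fixes W W' :: "'a::comm_ring_1^'n^'n" and Z Z' :: "'a^'m^'m"
  shows "block_matrix W X Y Z ** block_matrix W' X' Y' Z' =
    block_matrix (W ** W' + X ** Y') (W ** X' + X ** Z') (Y ** W' + Z ** Y') (Y ** X' + Z ** Z')"
  by (simp add: vec_eq_iff block_matrix_def matrix_matrix_mult_def sum_UNIV_sum_type split: sum.split)

lemma det_block_lower:
  fixes Z :: "'a::comm_ring_1^'m^'m"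
  shows "det (block_matrix (mat 1 :: 'a^'n^'n) 0 Y Z) = det Z"
proof -
  have "i \<in> range Inl" if "i \<notin> range (Inr :: 'm \<Rightarrow> 'n + 'm)" for i
    using that by (cases i) auto
  then have "det (block_matrix (mat 1 :: 'a^'n^'n) 0 Y Z)
      = det (\<chi> i j. block_matrix (mat 1 :: 'a^'n^'n) 0 Y Z $ Inr i $ Inr j)"
    by (intro det_eq_det_of_identity_rows)
      (auto simp: block_matrix_def mat_def vec_eq_iff split: sum.split)
  then show ?thesis by (simp add: block_matrix_def)
qed

lemma det_block_upper:
  fixes W :: "'a::comm_ring_1^'n^'n"
  shows "det (block_matrix W X 0 (mat 1 :: 'a^'m^'m)) = det W"
proof -
  have "i \<in> range Inr" if "i \<notin> range (Inl :: 'n \<Rightarrow> 'n + 'm)" for i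
    using that by (cases i) auto
  then have "det (block_matrix W X 0 (mat 1 :: 'a^'m^'m))
      = det (\<chi> i j. block_matrix W X 0 (mat 1 :: 'a^'m^'m) $ Inl i $ Inl j)"
    by (intro det_eq_det_of_identity_rows)
      (auto simp: block_matrix_def mat_def vec_eq_iff split: sum.split)
  then show ?thesis by (simp add: block_matrix_def)
qed

text \<open>The block matrix with identity diagonal blocks and off-diagonal blocks \<open>X\<close>,
  \<open>Y\<close> factors in two ways into block triangular matrices. In each factorization one
  factor has determinant 1.\<close>

lemma det_one_minus_commute:
  fixes X :: "'a::comm_ring_1^'m^'n" and Y :: "'a^'n^'m"
  shows "det (mat 1 - X ** Y) = det (mat 1 - Y ** X)"
proof -
  let ?I = "mat 1 :: 'a^'n^'n" and ?J = "mat 1 :: 'a^'m^'m"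
  have tr: "det (block_matrix ?I 0 Y ?J) = 1" "det (block_matrix ?I X 0 ?J) = 1"
    by (simp_all add: det_block_lower det_block_upper)
  have "block_matrix (?I - X ** Y) X 0 ?J ** block_matrix ?I 0 Y ?J
      = block_matrix ?I 0 Y (?J - Y ** X) ** block_matrix ?I X 0 ?J"
    by (simp add: block_matrix_mult)
  from arg_cong[OF this, of det] show ?thesis
    by (simp add: det_mul tr det_block_lower det_block_upper)
qed

section \<open>The information determinant of a set of rows\<close>

lemma matrix_diff_ldistrib:
  fixes X :: "'a::ring_1^'m^'n" and Y Z :: "'a^'k^'m"
  shows "X ** (Y - Z) = X ** Y - X ** Z"
  by (simp add: vec_eq_iff matrix_matrix_mult_def right_diff_distrib sum_subtractf)

lemma matrix_diff_rdistrib: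
  fixes X Y :: "'a::ring_1^'m^'n" and Z :: "'a^'k^'m"
  shows "(X - Y) ** Z = X ** Z - Y ** Z"
  by (simp add: vec_eq_iff matrix_matrix_mult_def left_diff_distrib sum_subtractf)

lemma matrix_inv_mult:
  fixes H :: "'a::semiring_1^'n^'n"
  assumes "invertible H"
  shows "H ** matrix_inv H = mat 1" "matrix_inv H ** H = mat 1"
  using someI_ex[OF assms[unfolded invertible_def]] unfolding matrix_inv_def by auto

text \<open>Zeroing the rows in \<open>S\<close> turns the sum over the complement into a genuine
  matrix product, to which the exchange identity applies.\<close>

lemma gram_rows_eq_diff:
  fixes A :: "real^'m^'n"
  shows "gram_rows A S = transpose A ** A - transpose A ** (\<chi> i. if i \<in> S then 0 else A $ i)"
proof -
  have "(\<Sum>i\<in>S. A $ i $ j * A $ i $ k)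
      = (\<Sum>i\<in>UNIV. A $ i $ j * A $ i $ k - A $ i $ j * (if i \<in> S then 0 else A $ i) $ k)" for j k
    by (rule sum.mono_neutral_cong_left) auto
  then show ?thesis
    by (simp add: vec_eq_iff gram_rows_def matrix_matrix_mult_def transpose_def sum_subtractf)
qed

text \<open>The matrix \<open>K\<close> is left general so that both instances are covered, each
  with its own \<open>B\<close>-term.\<close>

lemma det_gram_rows_add:
  fixes A :: "real^'m^'n" and K :: "real^'m^'m"
  defines "H \<equiv> transpose A ** A + K"
  assumes H: "invertible H"
  shows "det (gram_rows A S + K) = det H *
    det (\<chi> i. if i \<in> S then mat 1 $ i else (mat 1 - A ** matrix_inv H ** transpose A) $ i)"
proof -
  let ?A = "\<chi> i. if i \<in> S then 0 else A $ i"
  let ?X = "matrix_inv H ** transpose A"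
  have "gram_rows A S + K = H - transpose A ** ?A"
    unfolding H_def gram_rows_eq_diff by simp
  also have "\<dots> = H ** (mat 1 - ?X ** ?A)"
    by (simp add: matrix_diff_ldistrib matrix_mul_assoc matrix_inv_mult(1)[OF H])
  finally have "det (gram_rows A S + K) = det H * det (mat 1 - ?A ** ?X)"
    by (simp only: det_mul det_one_minus_commute[of ?A ?X])
  \<comment> \<open>A zero row of \<open>?A\<close> gives a zero row of the product, hence an
    identity row of the difference.\<close>
  also have "mat 1 - ?A ** ?X
      = (\<chi> i. if i \<in> S then mat 1 $ i else (mat 1 - A ** matrix_inv H ** transpose A) $ i)"
    by (simp add: vec_eq_iff matrix_mul_assoc[symmetric])
      (simp add: matrix_matrix_mult_def)
  finally show ?thesis .
qed

section \<open>Quadratic forms and positive definiteness\<close>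

lemma inner_transpose_mult:
  fixes A :: "real^'m^'n"
  shows "(transpose A *v z) \<bullet> x = z \<bullet> (A *v x)"
  by (simp add: dot_lmul_matrix)

lemma inner_gram_mult:
  fixes A :: "real^'m^'n" and B :: "real^'m^'q"
  shows "((transpose A ** A + transpose B ** B) *v x) \<bullet> x = (norm (A *v x))\<^sup>2 + (norm (B *v x))\<^sup>2"
  by (simp add: matrix_vector_mult_add_rdistrib inner_add_left inner_transpose_mult
      power2_norm_eq_inner flip: matrix_vector_mul_assoc del: transpose_matrix_vector)

lemma pos_def_det_nonzero:
  fixes H :: "real^'n^'n"
  assumes "\<And>x. x \<noteq> 0 \<Longrightarrow> (H *v x) \<bullet> x > 0"
  shows "det H \<noteq> 0"
proof -
  have "\<forall>x. H *v x = 0 \<longrightarrow> x = 0" using assms by force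
  then show ?thesis
    by (metis invertible_det_nz invertible_left_inverse matrix_left_invertible_ker)
qed

lemma pos_def_det_pos:
  fixes H :: "real^'n^'n"
  assumes H: "\<And>x. x \<noteq> 0 \<Longrightarrow> (H *v x) \<bullet> x > 0"
  shows "det H > 0"
proof (rule ccontr)
  txt \<open>On the segment from the identity to \<open>H\<close> the determinant never vanishes.\<close>
  let ?M = "\<lambda>t::real. (1 - t) *\<^sub>R mat 1 + t *\<^sub>R H"
  let ?f = "\<lambda>t. det (?M t)"
  assume "\<not> det H > 0"
  moreover have "continuous_on {0..1} ?f"
    unfolding det_def by (intro continuous_intros)
  ultimately obtain t where t: "0 \<le> t" "t \<le> 1" "?f t = 0"
    using IVT2'[of ?f 1 0 0] by auto
  have "(?M t *v x) \<bullet> x > 0" if "x \<noteq> 0" for x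
  proof -
    have "(?M t *v x) \<bullet> x = (1 - t) * (x \<bullet> x) + t * ((H *v x) \<bullet> x)"
      by (simp add: matrix_vector_mult_add_rdistrib inner_add_left scaleR_matrix_vector_assoc[symmetric])
    moreover have "x \<bullet> x > 0" "(H *v x) \<bullet> x > 0" using that H by auto
    \<comment> \<open>Strict positivity comes from the identity when \<open>t < 1\<close> and from
      \<open>H\<close> when \<open>t = 1\<close>.\<close>
    ultimately show ?thesis using t
      by (cases "t = 1") (auto intro!: add_pos_nonneg)
  qed
  with pos_def_det_nonzero[of "?M t"] t show False by simp
qed

section \<open>Eigenvalues and square roots from the Schur form\<close>

lemma diagonal_matrix_mult_component:
  assumes "diagonal_matrix L"
  shows "(L *v w) $ i = L $ i $ i * w $ i"
proof -
  have "(L *v w) $ i = (\<Sum>j\<in>UNIV. if j = i then L $ i $ i * w $ i else 0)"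
    unfolding matrix_vector_mult_def vec_lambda_beta
    by (rule sum.cong[OF refl]) (use assms in \<open>auto simp: diagonal_matrix_def\<close>)
  then show ?thesis by simp
qed

text \<open>The change of coordinates by \<open>\<Phi>\<close> matches eigenvectors of
  \<open>C\<close> with those of \<open>\<Lambda>\<close>. The eigenvalue set is thereby finite and
  nonempty, so the \<open>Max\<close> in \<open>greatest_eigenvalue\<close> is a true
  maximum.\<close>

lemma real_schur_eigenvalues:
  assumes "real_schur C \<Phi> \<Lambda>"
  shows "{l. \<exists>v. v \<noteq> 0 \<and> C *v v = l *\<^sub>R v} = range (\<lambda>i. \<Lambda> $ i $ i)"
proof -
  have orth: "transpose \<Phi> ** \<Phi> = mat 1" "\<Phi> ** transpose \<Phi> = mat 1"
    and diag: "diagonal_matrix \<Lambda>" and C: "C = \<Phi> ** \<Lambda> ** transpose \<Phi>"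
    using assms by (auto simp: real_schur_def orthogonal_matrix_def)
  have "l \<in> range (\<lambda>i. \<Lambda> $ i $ i)" if v: "v \<noteq> 0" "C *v v = l *\<^sub>R v" for l v
  proof -
    let ?w = "transpose \<Phi> *v v"
    have "\<Phi> *v ?w = v" by (simp only: matrix_vector_mul_assoc orth matrix_vector_mul_lid)
    then have "?w \<noteq> 0" using v(1) by (metis matrix_vector_mult_0_right)
    then obtain i where i: "?w $ i \<noteq> 0" by (metis vec_eq_iff zero_index)
    have "\<Lambda> *v ?w = (transpose \<Phi> ** \<Phi>) *v (\<Lambda> *v ?w)"
      by (simp only: orth matrix_vector_mul_lid)
    also have "\<dots> = transpose \<Phi> *v (C *v v)"
      by (simp only: C matrix_vector_mul_assoc matrix_mul_assoc)
    also have "\<dots> = l *\<^sub>R ?w"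
      by (simp only: v(2) matrix_vector_mult_scaleR)
    finally have "l * ?w $ i = \<Lambda> $ i $ i * ?w $ i"
      using diagonal_matrix_mult_component[OF diag, of ?w i] by simp
    with i have "l = \<Lambda> $ i $ i" by (metis mult_right_cancel)
    then show ?thesis by blast
  qed
  moreover have "\<exists>v. v \<noteq> 0 \<and> C *v v = (\<Lambda> $ i $ i) *\<^sub>R v" for i
  proof (intro exI conjI)
    let ?e = "axis i 1 :: real^'a" and ?v = "\<Phi> *v axis i 1"
    have e: "transpose \<Phi> *v ?v = ?e" by (simp only: matrix_vector_mul_assoc orth matrix_vector_mul_lid)
    then show "?v \<noteq> 0" by (metis axis_eq_0_iff matrix_vector_mult_0_right zero_neq_one)
    have L: "\<Lambda> *v ?e = (\<Lambda> $ i $ i) *\<^sub>R ?e"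
      by (simp add: vec_eq_iff diagonal_matrix_mult_component[OF diag] axis_def)
    have "C *v ?v = \<Phi> *v (\<Lambda> *v (transpose \<Phi> *v ?v))"
      by (simp only: C matrix_vector_mul_assoc matrix_mul_assoc)
    then show "C *v ?v = (\<Lambda> $ i $ i) *\<^sub>R ?v"
      by (simp only: e L matrix_vector_mult_scaleR)
  qed
  ultimately show ?thesis by blast
qed

lemma diag_sqrt_gram:
  assumes "diagonal_matrix L" "\<And>i. 0 \<le> L $ i $ i"
  shows "transpose (diag_sqrt L) ** diag_sqrt L = L" "diag_sqrt L ** transpose (diag_sqrt L) = L"
proof -
  have "transpose (diag_sqrt L) = diag_sqrt L"
    by (simp add: vec_eq_iff transpose_def diag_sqrt_def)
  moreover have "(diag_sqrt L ** diag_sqrt L) $ i $ j = L $ i $ j" for i j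
  proof -
    have "(diag_sqrt L ** diag_sqrt L) $ i $ j = (\<Sum>k\<in>UNIV. if k = i then if i = j then L $ i $ i else 0 else 0)"
      unfolding matrix_matrix_mult_def diag_sqrt_def vec_lambda_beta
      by (rule sum.cong[OF refl]) (use assms in auto)
    then show ?thesis using assms by (simp add: diagonal_matrix_def)
  qed
  ultimately show "transpose (diag_sqrt L) ** diag_sqrt L = L" "diag_sqrt L ** transpose (diag_sqrt L) = L"
    by (simp_all, simp_all add: vec_eq_iff)
qed

section \<open>The residual matrix: semidefiniteness and nonvanishing\<close>

text \<open>The vector \<open>y\<close> solves the normal equations of regularized least squares,
  and the quadratic form at \<open>x\<close> equals the attained cost
  \<open>|x - A y|^2 + |B y|^2\<close>.\<close>

lemma residual_matrix_psd:
  fixes A :: "real^'m^'n" and B :: "real^'m^'q"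
  defines "H \<equiv> transpose A ** A + transpose B ** B"
  assumes H: "invertible H"
  shows "0 \<le> ((mat 1 - A ** matrix_inv H ** transpose A) *v x) \<bullet> x"
proof -
  define y where "y = matrix_inv H *v (transpose A *v x)"
  have Hy: "H *v y = transpose A *v x"
    unfolding y_def by (simp only: matrix_vector_mul_assoc matrix_inv_mult(1)[OF H] matrix_mul_lid matrix_mul_assoc)
  have "(mat 1 - A ** matrix_inv H ** transpose A) *v x = x - A *v y"
    unfolding y_def
    by (simp only: matrix_vector_mult_diff_rdistrib matrix_vector_mul_lid matrix_vector_mul_assoc matrix_mul_assoc)
  moreover have "x \<bullet> (A *v y) = (norm (A *v y))\<^sup>2 + (norm (B *v y))\<^sup>2"
    using inner_gram_mult[of A B y] unfolding H_def[symmetric] Hy inner_transpose_mult .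
  then have "(x - A *v y) \<bullet> x = (norm (x - A *v y))\<^sup>2 + (norm (B *v y))\<^sup>2"
    by (simp add: power2_norm_eq_inner inner_diff_left inner_diff_right inner_commute)
  ultimately show ?thesis by simp
qed

lemma residual_matrix_zero_rank:
  fixes A :: "real^'m^'n" and B :: "real^'m^'q"
  defines "H \<equiv> transpose A ** A + transpose B ** B"
  assumes H: "invertible H" and zero: "mat 1 - A ** matrix_inv H ** transpose A = 0"
  shows "CARD('n) + rank B \<le> CARD('m)"
proof -
  let ?W = "matrix_inv H ** transpose A"
  have AW: "A ** ?W = mat 1" using zero by (simp add: matrix_mul_assoc)
  \<comment> \<open>Both \<open>H ** ?W\<close> and \<open>transpose A ** A ** ?W\<close> equal
    \<open>transpose A\<close>, so their difference vanishes.\<close>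
  have "transpose B ** B ** ?W = (H - transpose A ** A) ** ?W"
    by (simp add: H_def)
  also have "\<dots> = H ** matrix_inv H ** transpose A - transpose A ** (A ** ?W)"
    by (simp only: matrix_diff_rdistrib matrix_mul_assoc)
  also have "\<dots> = 0" by (simp add: matrix_inv_mult(1)[OF H] AW)
  finally have BBW: "transpose B ** B ** ?W = 0" .
  have BW: "B *v (?W *v x) = 0" for x
  proof -
    have "transpose B *v (B *v (?W *v x)) = 0"
      using arg_cong[OF BBW, of "\<lambda>M. M *v x"] by (simp add: matrix_vector_mul_assoc matrix_mul_assoc)
    then have "(B *v (?W *v x)) \<bullet> (B *v (?W *v x)) = 0"
      using inner_transpose_mult[of B "B *v (?W *v x)" "?W *v x"] by (simp del: transpose_matrix_vector)
    then show ?thesis by simp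
  qed
  have "inj ((*v) ?W)"
    using AW matrix_left_invertible_injective by blast
  then have rW: "rank ?W = CARD('n)" by (simp add: full_rank_injective)
  \<comment> \<open>The row space of \<open>B\<close> is orthogonal to the image of
    \<open>?W\<close>, which lies in the kernel of \<open>B\<close>; so the dimensions add up inside
    the \<open>m\<close>-dimensional space.\<close>
  have "dim (range ((*v) (transpose B)) \<union> range ((*v) ?W))
      = dim (range ((*v) (transpose B))) + dim (range ((*v) ?W))"
    by (rule dim_orthogonal_sum) (auto simp: inner_transpose_mult BW simp del: transpose_matrix_vector)
  also have "\<dots> = rank B + CARD('n)"
    using rank_dim_range[of "transpose B"] rank_dim_range[of ?W] rW by (simp add: rank_transpose)
  finally show ?thesis
    using dim_subset_UNIV[of "range ((*v) (transpose B)) \<union> range ((*v) ?W)"] by simp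
qed

section \<open>Equivalence of the two design problems\<close>

lemma vstack_mult_eq_0:
  fixes A :: "real^'m^'n" and B :: "real^'m^'q"
  assumes "A *v x = 0" "B *v x = 0"
  shows "vstack A B *v x = 0"
  using assms by (simp add: vec_eq_iff vstack_def matrix_vector_mult_def split: sum.split)

lemma ln_ext_scaled:
  assumes "0 < h" "0 < l"
  shows "ln_ext ((1 / l) ^ k * d) + ereal (ln h + real k * ln l) = ln_ext (h * d)"
  using assms
  by (auto simp: ln_ext_def zero_less_mult_iff ln_mult ln_realpow ln_div power_one_over[symmetric])

theorem theorem14:
  fixes A :: "real^'m^'n" and B :: "real^'m^'q" and s :: nat
    and C \<Phi> \<Lambda> :: "real^'n^'n" and lmax :: real
  assumes "valid_dopt (DOpt A B s)"
    and "C = mat 1 - A ** matrix_inv (transpose A ** A + transpose B ** B) ** transpose A"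
    and "lmax = greatest_eigenvalue C"
    and "real_schur C \<Phi> \<Lambda>"
  shows "completely_equivalent
           (add_const (dopt_problem (map_D \<Phi> \<Lambda> (map_M (DOpt A B s))))
              (ln (det (transpose A ** A + transpose B ** B)) + real (CARD('n) - s) * ln lmax))
           (dopt_problem (DOpt A B s))"
proof -
  define H where "H = transpose A ** A + transpose B ** B"
  have C: "C = mat 1 - A ** matrix_inv H ** transpose A"
    using assms(2) by (simp add: H_def)
  have rk: "rank (vstack A B) = CARD('m)" and s: "s < CARD('n)" "CARD('m) \<le> s + rank B"
    using assms(1) by auto
  have "(H *v x) \<bullet> x > 0" if "x \<noteq> 0" for x
  proof -
    have "A *v x \<noteq> 0 \<or> B *v x \<noteq> 0"
      using that rk vstack_mult_eq_0[of A x B] by (metis matrix_nonfull_linear_equations_eq)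
    then show ?thesis
      unfolding H_def inner_gram_mult by (auto intro: add_pos_nonneg add_nonneg_pos)
  qed
  then have detH: "det H > 0" by (rule pos_def_det_pos)
  then have inv: "invertible H" by (simp add: invertible_det_nz)
  have orth: "transpose \<Phi> ** \<Phi> = mat 1" "\<Phi> ** transpose \<Phi> = mat 1"
    and diag: "diagonal_matrix \<Lambda>" and schur: "C = \<Phi> ** \<Lambda> ** transpose \<Phi>"
    using assms(4) by (auto simp: real_schur_def orthogonal_matrix_def)
  have ev: "{l. \<exists>v. v \<noteq> 0 \<and> C *v v = l *\<^sub>R v} = range (\<lambda>i. \<Lambda> $ i $ i)"
    by (rule real_schur_eigenvalues[OF assms(4)])
  have lmax: "lmax = Max (range (\<lambda>i. \<Lambda> $ i $ i))"
    unfolding assms(3) greatest_eigenvalue_def ev ..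
  have nonneg: "0 \<le> \<Lambda> $ i $ i" for i
  proof -
    have "\<Lambda> $ i $ i \<in> {l. \<exists>v. v \<noteq> 0 \<and> C *v v = l *\<^sub>R v}" unfolding ev by simp
    then obtain v where v: "v \<noteq> 0" "C *v v = (\<Lambda> $ i $ i) *\<^sub>R v" by blast
    have "0 \<le> (C *v v) \<bullet> v"
      using residual_matrix_psd[of A B v] inv unfolding C H_def by blast
    moreover have "v \<bullet> v > 0" using v(1) by simp
    ultimately show ?thesis by (simp add: v(2) zero_le_mult_iff)
  qed
  have le: "\<Lambda> $ i $ i \<le> lmax" for i unfolding lmax by simp
  have lpos: "lmax > 0"
  proof (rule ccontr)
    assume "\<not> lmax > 0"
    then have "\<Lambda> $ i $ i = 0" for i using le[of i] nonneg[of i] by linarith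
    then have "\<Lambda> = 0" using diag by (metis (no_types) diagonal_matrix_def vec_eq_iff zero_index)
    then have "C = 0" by (simp add: schur)
    then have "CARD('n) + rank B \<le> CARD('m)"
      using residual_matrix_zero_rank[of A B] inv unfolding C H_def by blast
    with s show False by simp
  qed
  let ?D = "mat 1 - (1 / lmax) *\<^sub>R \<Lambda>"
  define A' where "A' = \<Phi> ** diag_sqrt ?D"
  define B' where "B' = (1 / sqrt lmax) *\<^sub>R diag_sqrt \<Lambda>"
  have D: "diagonal_matrix ?D" "0 \<le> ?D $ i $ i" for i
    using diag le[of i] lpos by (auto simp: diagonal_matrix_def mat_def)
  have "transpose A' ** A' = transpose (diag_sqrt ?D) ** (transpose \<Phi> ** \<Phi>) ** diag_sqrt ?D"
    by (simp only: A'_def matrix_transpose_mul matrix_mul_assoc)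
  also have "\<dots> = ?D" by (simp add: orth diag_sqrt_gram[OF D])
  finally have AA: "transpose A' ** A' = ?D" .
  have "transpose B' = (1 / sqrt lmax) *\<^sub>R transpose (diag_sqrt \<Lambda>)"
    by (simp add: B'_def vec_eq_iff transpose_def)
  then have BB: "transpose B' ** B' = (1 / lmax) *\<^sub>R \<Lambda>"
    using lpos diag_sqrt_gram[OF diag nonneg]
    by (simp add: B'_def matrix_scalar_ac flip: scalar_matrix_assoc)
  have H': "transpose A' ** A' + transpose B' ** B' = mat 1" by (simp add: AA BB)
  have "A' ** transpose A' = \<Phi> ** (diag_sqrt ?D ** transpose (diag_sqrt ?D)) ** transpose \<Phi>"
    by (simp only: A'_def matrix_transpose_mul matrix_mul_assoc)
  also have "\<dots> = mat 1 - (1 / lmax) *\<^sub>R C"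
    by (simp add: diag_sqrt_gram[OF D] schur orth matrix_diff_ldistrib matrix_diff_rdistrib matrix_scalar_ac flip: scalar_matrix_assoc)
  finally have AA': "mat 1 - A' ** transpose A' = (1 / lmax) *\<^sub>R C" by simp
  have inv1: "matrix_inv (mat 1 :: real^'n^'n) = mat 1"
    using matrix_inv_mult(1)[of "mat 1 :: real^'n^'n"] by (simp add: invertible_det_nz)
  have "ldet (gram_rows A' S + transpose B' ** B') + ereal (ln (det H) + real (CARD('n) - s) * ln lmax)
      = ldet (gram_rows A S + transpose B ** B)" if S: "card S = s" for S
  proof -
    let ?d = "det (\<chi> i. if i \<in> S then mat 1 $ i else C $ i)"
    let ?c = "\<lambda>i. if i \<in> S then 1 else 1 / lmax"
    have "det (gram_rows A' S + transpose B' ** B')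
        = det (\<chi> i. if i \<in> S then mat 1 $ i else ((1 / lmax) *\<^sub>R C) $ i)"
      using det_gram_rows_add[of A' "transpose B' ** B'" S, unfolded H' inv1 matrix_mul_rid AA']
      by (simp add: invertible_det_nz)
    also have "\<dots> = det (\<chi> i. ?c i *s (if i \<in> S then mat 1 $ i else C $ i))"
      by (intro arg_cong[where f = det]) (simp add: vec_eq_iff)
    also have "\<dots> = prod ?c UNIV * ?d"
      by (rule det_rows_mul)
    also have "prod ?c UNIV = (1 / lmax) ^ card (- S)"
      by (simp add: prod.If_cases)
    also have "card (- S) = CARD('n) - s"
      by (simp add: Compl_eq_Diff_UNIV card_Diff_subset S)
    finally have 1: "det (gram_rows A' S + transpose B' ** B') = (1 / lmax) ^ (CARD('n) - s) * ?d" .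
    have 2: "det (gram_rows A S + transpose B ** B) = det H * ?d"
      using det_gram_rows_add[of A "transpose B ** B" S, folded H_def, folded C] inv by blast
    show ?thesis
      unfolding ldet_def 1 2 by (rule ln_ext_scaled[OF detH lpos])
  qed
  moreover have "map_D \<Phi> \<Lambda> (map_M (DOpt A B s)) = DOpt A' B' s"
    using s(1) by (simp add: A'_def B'_def flip: assms(2,3))
  ultimately show ?thesis
    by (simp add: completely_equivalent_def add_const_def H_def)
qed

end
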